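(* Let $k\ge 1$ and let $n, s_1,\ldots,s_k$ be integers with $1\leq s_{1}<s_{2}<\ldots<s_{k}<n$. Let $G=C_{2n}(s_{1},s_{2},\ldots,s_{k},n)$ be the circulant graph of odd degree on $2n$ vertices, and let $f_G(n)$ be the number of rooted spanning forests in $G$. Then $$f_{G}(n)=\prod_{p=1}^{s_k}(2T_n(u_p)-2)(2T_n(v_p)+2),$$ where the numbers $u_p$ and $v_p$, $p=1,2,\ldots,s_k$, are respectively the (complex) roots, counted with multiplicity, of the algebraic equations $Q(u)-1=0$ and $Q(v)+1=0$, where $Q(w)=2k+2-2\sum_{i=1}^{k}T_{s_i}(w)$ and $T_s(w)$ is the Chebyshev polynomial of the first kind of degree $s$.
   Context: The circulant graph $C_{m}(t_1,\ldots,t_l)$ (with $1\le t_1<\ldots<t_l\le \frac m2$) is the simple undirected graph with vertices $0,1,\ldots,m-1$ in which each vertex $i$ is adjacent to the vertices $i\pm t_1,\ldots,i\pm t_l \pmod m$. In particular, in $C_{2n}(s_1,\ldots,s_k,n)$ each vertex $i$ is adjacent to $i\pm s_1,\ldots,i\pm s_k$ and, by a single edge, to $i+n \pmod{2n}$, so every vertex has degree $2k+1$. A rooted spanning forest of a graph is a spanning acyclic subgraph (containing all the vertices) together with a choice of one distinguished vertex (root) in each connected component. $T_n(z)=\cos(n\arccos z)$ denotes the Chebyshev polynomial of the first kind. *)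

theory Defs
  imports
    "HOL-Analysis.Analysis"
    "HOL-Computational_Algebra.Computational_Algebra"
    "HOL-Number_Theory.Cong"
begin

section \<open>Simple graphs and rooted spanning forests\<close>

text \<open>An undirected edge between \<open>x\<close> and \<open>y\<close> is the set \<open>{x, y}\<close>, so there are no parallel
  edges.\<close>

record 'a sgraph =
  vertices :: "'a set"
  edges :: "'a set set"

definition circulant_graph :: "nat \<Rightarrow> nat set \<Rightarrow> nat sgraph" where
  "circulant_graph m J =
     \<lparr>vertices = {0..<m},
      edges = {{i, j} | i j. i < m \<and> j < m \<and> i \<noteq> j \<and>
                 (\<exists>t\<in>J. [int j = int i + int t] (mod int m) \<or>
                        [int j = int i - int t] (mod int m))}\<rparr>"

definition is_cycle :: "'a set set \<Rightarrow> 'a list \<Rightarrow> bool" where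
  "is_cycle F c \<longleftrightarrow>
     length c \<ge> 3 \<and> distinct c \<and>
     (\<forall>i < length c. {c ! i, c ! (Suc i mod length c)} \<in> F)"

definition graph_components :: "'a set \<Rightarrow> 'a set set \<Rightarrow> 'a set set" where
  "graph_components V F = V // {(x, y). {x, y} \<in> F}\<^sup>*"

text \<open>A spanning forest contains all vertices, so it is determined by its edge set \<open>F\<close>; the choice
  of roots is the set \<open>R\<close> of distinguished vertices.\<close>

definition rooted_spanning_forests :: "'a sgraph \<Rightarrow> ('a set set \<times> 'a set) set" where
  "rooted_spanning_forests G =
     {(F, R). F \<subseteq> edges G \<and> (\<nexists>c. is_cycle F c) \<and>
              R \<subseteq> vertices G \<and> (\<forall>C \<in> graph_components (vertices G) F. \<exists>!r. r \<in> R \<inter> C)}"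

definition num_rooted_spanning_forests :: "'a sgraph \<Rightarrow> nat" where
  "num_rooted_spanning_forests G = card (rooted_spanning_forests G)"


section \<open>Chebyshev polynomials\<close>

text \<open>Taken as polynomials, so that root multiplicities make sense; \<open>poly_chebyshev_T\<close> below gives the
  closed form \<open>T\<^sub>n(z) = cos (n arccos z)\<close> for all complex \<open>z\<close>.\<close>

fun chebyshev_T :: "nat \<Rightarrow> complex poly" where
  "chebyshev_T 0 = 1"
| "chebyshev_T (Suc 0) = [:0, 1:]"
| "chebyshev_T (Suc (Suc n)) = [:0, 2:] * chebyshev_T (Suc n) - chebyshev_T n"

lemma poly_chebyshev_T_cos: "poly (chebyshev_T n) (cos z) = cos (of_nat n * z)"
proof (induction n rule: chebyshev_T.induct)
  case (3 n)
  have "cos (of_nat (Suc (Suc n)) * z) + cos (of_nat n * z) = 2 * cos z * cos (of_nat (Suc n) * z)"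
    using cos_add[of "of_nat (Suc n) * z" z] cos_diff[of "of_nat (Suc n) * z" z]
    by (simp add: algebra_simps)
  with 3 show ?case
    by (simp add: algebra_simps)
qed simp_all

lemma poly_chebyshev_T: "poly (chebyshev_T n) z = cos (of_nat n * Arccos z)"
  using poly_chebyshev_T_cos[of n "Arccos z"] by simp

definition Q_poly :: "nat \<Rightarrow> (nat \<Rightarrow> nat) \<Rightarrow> complex poly" where
  "Q_poly k s = of_nat (2 * k + 2) - 2 * (\<Sum>i = 1..k. chebyshev_T (s i))"

end

theory Submission
  imports Defs "Jordan_Normal_Form.Determinant"
begin

text \<open>The number of rooted spanning forests of a graph with Laplacian matrix \<open>L\<close> is \<open>det (I + L)\<close>
  (\<open>matrix_forest_theorem\<close>).  Orienting a rooted forest towards its roots turns it into a function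
  that assigns to each vertex its parent, a neighbour or nothing, such that iterating it always ends
  at a root (\<open>bij_betw_parent_functions_forests\<close>).  On the other side, each row of \<open>I + L\<close> is a sum
  over the possible parents of a vertex, so by multilinearity \<open>det (I + L)\<close> is a sum over all parent
  functions; an acyclic function contributes 1 and any other 0 (\<open>det_parent_function\<close>).

  For a circulant graph, \<open>I + L\<close> is a circulant matrix, which the Fourier matrix diagonalises
  (\<open>det_circulant\<close>).  For the graph with \<open>2n\<close> vertices, the eigenvalue with index \<open>l\<close> is
  \<open>Q(cos (\<pi>l/n)) - (-1)\<^sup>l\<close> (\<open>circulant_eigenvalue\<close>).  The even indices give the values of \<open>Q - 1\<close> at
  the numbers \<open>cos (2\<pi>j/n)\<close>, the odd ones the values of \<open>Q + 1\<close> at \<open>cos (\<pi>/n + 2\<pi>j/n)\<close>.  Decomposing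
  these polynomials into linear factors and exchanging the products leaves, for each root \<open>r\<close>, a product
  of \<open>r\<close> minus these cosines, which is \<open>2 T\<^sub>n(r) - 2\<close> or \<open>2 T\<^sub>n(r) + 2\<close> up to a power of 2 and a sign
  (\<open>chebyshev_prod_cos\<close>).  The leading coefficient of \<open>Q\<close> is minus the power of 2 with exponent
  \<open>s\<^sub>k\<close>, which cancels the powers of 2, and the signs agree for the two families, so they cancel as
  well.\<close>

(* Leaves $ with one meaning, the entry of a vector whose dimension is not part of its type. *)
unbundle no vec_syntax
no_notation fps_nth (infixl "$" 75)

section \<open>Parent functions\<close>

text \<open>The middle argument is the number of parent steps.  Carrying it along makes the depth of a vertex
  available as a well-founded measure: \<open>f\<close> may be cyclic, so depth cannot be defined by recursion.\<close>

inductive reaches_root :: "('a \<Rightarrow> 'a option) \<Rightarrow> 'a \<Rightarrow> nat \<Rightarrow> 'a \<Rightarrow> bool"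
  for f :: "'a \<Rightarrow> 'a option" where
  root: "f r = None \<Longrightarrow> reaches_root f r 0 r"
| step: "f v = Some w \<Longrightarrow> reaches_root f w d r \<Longrightarrow> reaches_root f v (Suc d) r"

lemma reaches_root_None: "f v = None \<Longrightarrow> reaches_root f v d r \<longleftrightarrow> d = 0 \<and> r = v"
  by (subst reaches_root.simps) auto

lemma reaches_root_Some:
  "f v = Some w \<Longrightarrow> reaches_root f v d r \<longleftrightarrow> (\<exists>d'. d = Suc d' \<and> reaches_root f w d' r)"
  by (subst reaches_root.simps) auto

lemma reaches_root_unique:
  assumes "reaches_root f v d r" "reaches_root f v d' r'"
  shows "d = d' \<and> r = r'"
  using assms
  by (induction arbitrary: d') (auto simp: reaches_root_None reaches_root_Some)

definition grounded :: "('a \<Rightarrow> 'a option) \<Rightarrow> 'a \<Rightarrow> bool" where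
  "grounded f v \<longleftrightarrow> (\<exists>d r. reaches_root f v d r)"

lemma grounded_None: "f v = None \<Longrightarrow> grounded f v"
  by (auto simp: grounded_def reaches_root_None)

lemma grounded_Some: "f v = Some w \<Longrightarrow> grounded f v \<longleftrightarrow> grounded f w"
  by (auto simp: grounded_def reaches_root_Some)

lemma grounded_induct [consumes 1, case_names root step]:
  assumes "grounded f v"
    and "\<And>r. f r = None \<Longrightarrow> P r"
    and "\<And>v w. f v = Some w \<Longrightarrow> grounded f w \<Longrightarrow> P w \<Longrightarrow> P v"
  shows "P v"
proof -
  obtain d r where "reaches_root f v d r"
    using assms(1) by (auto simp: grounded_def)
  thus ?thesis
  proof induction
    case (step v w d r)
    thus ?case using assms(3) by (auto simp: grounded_def)
  qed (rule assms(2))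
qed

definition depth :: "('a \<Rightarrow> 'a option) \<Rightarrow> 'a \<Rightarrow> nat" where
  "depth f v = (THE d. \<exists>r. reaches_root f v d r)"

lemma depth_eq: "reaches_root f v d r \<Longrightarrow> depth f v = d"
  unfolding depth_def by (rule the_equality) (auto dest: reaches_root_unique)

lemma depth_Some: "grounded f w \<Longrightarrow> f v = Some w \<Longrightarrow> depth f v = Suc (depth f w)"
  by (metis depth_eq grounded_def reaches_root.step)

definition parent_edges :: "'a set \<Rightarrow> ('a \<Rightarrow> 'a option) \<Rightarrow> 'a set set" where
  "parent_edges V f = {{v, w} | v w. v \<in> V \<and> f v = Some w}"

definition parentless :: "'a set \<Rightarrow> ('a \<Rightarrow> 'a option) \<Rightarrow> 'a set" where
  "parentless V f = {v \<in> V. f v = None}"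

definition neighbours :: "'a set set \<Rightarrow> 'a \<Rightarrow> 'a set" where
  "neighbours E v = {w. {v, w} \<in> E}"

definition parent_functions :: "'a set \<Rightarrow> 'a set set \<Rightarrow> ('a \<Rightarrow> 'a option) set" where
  "parent_functions V E = (\<Pi>\<^sub>E v\<in>V. insert None (Some ` neighbours E v))"

abbreviation edge_rel :: "'a set set \<Rightarrow> ('a \<times> 'a) set" where
  "edge_rel F \<equiv> {(x, y). {x, y} \<in> F}"

lemma edge_rel_rtrancl_sym: "(x, y) \<in> (edge_rel F)\<^sup>* \<Longrightarrow> (y, x) \<in> (edge_rel F)\<^sup>*"
proof -
  have "sym (edge_rel F)"
    by (auto simp: sym_def insert_commute)
  thus "(x, y) \<in> (edge_rel F)\<^sup>* \<Longrightarrow> (y, x) \<in> (edge_rel F)\<^sup>*"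
    using sym_rtrancl symD by metis
qed

text \<open>Speaking about the component of each vertex avoids the quotient set in all later arguments.\<close>

lemma unique_root_iff:
  "(\<forall>C \<in> graph_components V F. \<exists>!r. r \<in> R \<inter> C) \<longleftrightarrow>
   (\<forall>v\<in>V. \<exists>!r. r \<in> R \<and> (v, r) \<in> (edge_rel F)\<^sup>*)"
  by (simp add: graph_components_def quotient_def)

lemma rtrancl_imp_simple_path:
  assumes "(x, y) \<in> r\<^sup>*"
  shows "\<exists>p. p \<noteq> [] \<and> hd p = x \<and> last p = y \<and> distinct p \<and> successively (\<lambda>a b. (a, b) \<in> r) p"
  using assms
proof (induction rule: converse_rtrancl_induct)
  case base
  show ?case by (intro exI[of _ "[y]"]) simp
next
  case (step x z)
  then obtain p where p: "p \<noteq> []" "hd p = z" "last p = y" "distinct p"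
    "successively (\<lambda>a b. (a, b) \<in> r) p" by blast
  show ?case
  proof (cases "x \<in> set p")
    case False
    with p step.hyps(1) show ?thesis
      by (intro exI[of _ "x # p"]) (auto simp: successively_Cons)
  next
    case True
    then obtain as bs where "p = as @ x # bs"
      by (meson split_list)
    with p show ?thesis
      by (intro exI[of _ "x # bs"]) (auto simp: successively_append_iff split: if_splits)
  qed
qed

text \<open>A simple path between the ends of \<open>{x, y}\<close> that avoids this edge has at least three vertices,
  so the edge closes it to a cycle.\<close>

lemma connected_by_other_edges_imp_cycle:
  assumes "{x, y} \<in> F" "x \<noteq> y" "(x, y) \<in> (edge_rel (F - {{x, y}}))\<^sup>*"
  shows "\<exists>c. is_cycle F c"
proof -
  obtain p where p: "p \<noteq> []" "hd p = x" "last p = y" "distinct p"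
    and succ: "successively (\<lambda>a b. (a, b) \<in> edge_rel (F - {{x, y}})) p"
    using rtrancl_imp_simple_path[OF assms(3)] by blast
  have "length p \<noteq> 0" "length p \<noteq> 1" "length p \<noteq> 2"
    using p succ assms(2) by (auto simp: length_Suc_conv numeral_2_eq_2)
  hence len: "length p \<ge> 3" by linarith
  have "{p ! i, p ! (Suc i mod length p)} \<in> F" if "i < length p" for i
  proof (cases "Suc i < length p")
    case True
    thus ?thesis
      using succ by (auto simp: successively_conv_nth)
  next
    case False
    hence "Suc i = length p" using that by simp
    hence "p ! i = y" "p ! (Suc i mod length p) = x"
      using p by (auto simp: last_conv_nth hd_conv_nth simp flip: \<open>Suc i = length p\<close>)
    thus ?thesis using assms(1) by (simp add: insert_commute)
  qed
  with len p(4) show ?thesis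
    by (auto simp: is_cycle_def)
qed

section \<open>Rooted forests as acyclic parent functions\<close>

locale simple_graph =
  fixes V :: "'a set" and E :: "'a set set"
  assumes edges_between_vertices: "E \<subseteq> {{x, y} | x y. x \<in> V \<and> y \<in> V \<and> x \<noteq> y}"
begin

lemma edge_ends: "{x, y} \<in> E \<Longrightarrow> x \<in> V \<and> y \<in> V \<and> x \<noteq> y"
proof -
  assume "{x, y} \<in> E"
  then obtain a b where "{x, y} = {a, b}" "a \<in> V" "b \<in> V" "a \<noteq> b"
    using edges_between_vertices by blast
  thus ?thesis by (auto simp: doubleton_eq_iff)
qed

definition grounded_parent_functions :: "('a \<Rightarrow> 'a option) set" where
  "grounded_parent_functions = {f \<in> parent_functions V E. \<forall>v\<in>V. grounded f v}"

lemma parent_edge: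
  assumes "f \<in> parent_functions V E" "v \<in> V" "f v = Some w"
  shows "{v, w} \<in> E"
  using PiE_mem[OF assms(1)[unfolded parent_functions_def] assms(2)] assms(3)
  by (auto simp: neighbours_def)

lemma parent_edges_iff:
  assumes "f \<in> parent_functions V E"
  shows "{v, w} \<in> parent_edges V f \<longleftrightarrow>
           v \<in> V \<and> w \<in> V \<and> (f v = Some w \<or> f w = Some v)"
proof -
  have "v \<in> V \<and> w \<in> V" if "v \<in> V \<and> f v = Some w" for v w
    using that parent_edge[OF assms] edge_ends by blast
  thus ?thesis
    unfolding parent_edges_def by (auto simp: doubleton_eq_iff)
qed

text \<open>On a cycle, take a vertex of maximal depth.  An edge joins a vertex to its parent, which is less
  deep, so both neighbours of the chosen vertex on the cycle would have to be its unique parent.\<close>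

lemma parent_edges_acyclic:
  assumes f: "f \<in> grounded_parent_functions"
  shows "\<not> is_cycle (parent_edges V f) c"
proof
  assume "is_cycle (parent_edges V f) c"
  hence len: "length c \<ge> 3" and dist: "distinct c"
    and edge: "\<And>i. i < length c \<Longrightarrow> {c ! i, c ! (Suc i mod length c)} \<in> parent_edges V f"
    by (auto simp: is_cycle_def)
  have f': "f \<in> parent_functions V E" and gr: "\<And>v. v \<in> V \<Longrightarrow> grounded f v"
    using f by (auto simp: grounded_parent_functions_def)
  define m where "m = length c"
  have m: "m \<ge> 3" using len by (simp add: m_def)
  have "finite (depth f ` set c)" "depth f ` set c \<noteq> {}"
    using len by auto
  then obtain i where i: "i < m" "Max (depth f ` set c) = depth f (c ! i)"
    using Max_in by (metis (no_types, lifting) imageE in_set_conv_nth m_def)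
  hence max: "depth f (c ! j) \<le> depth f (c ! i)" if "j < m" for j
    using that m_def by (metis List.finite_set Max_ge finite_imageI image_eqI nth_mem)
  have parent: "f (c ! i) = Some (c ! j)" if "j < m" "{c ! i, c ! j} \<in> parent_edges V f" for j
  proof -
    have "c ! i \<in> V" "c ! j \<in> V" "f (c ! i) = Some (c ! j) \<or> f (c ! j) = Some (c ! i)"
      using that(2) parent_edges_iff[OF f'] by auto
    thus ?thesis
      using depth_Some[of f "c ! i" "c ! j"] gr max[OF that(1)] by fastforce
  qed
  \<comment> \<open>The indices of the successor and the predecessor of \<open>c ! i\<close> on the cycle; they differ
    because a cycle has at least three vertices.\<close>
  define a where "a = Suc i mod m"
  define b where "b = (if i = 0 then m - 1 else i - 1)"
  have ab: "a < m" "b < m" "Suc b mod m = i"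
    using m i(1) by (auto simp: a_def b_def)
  have "f (c ! i) = Some (c ! a)"
    using parent[of a] edge[of i] i(1) ab by (simp add: m_def a_def)
  moreover have "f (c ! i) = Some (c ! b)"
    using parent[of b] edge[of b] i(1) ab by (simp add: m_def insert_commute)
  ultimately have "a = b"
    using dist ab nth_eq_iff_index_eq m_def by fastforce
  moreover have "a = Suc i \<or> i = m - 1 \<and> a = 0"
    using i(1) by (auto simp: a_def mod_Suc)
  ultimately show False
    using m i(1) by (auto simp: b_def split: if_splits)
qed

text \<open>The root is an invariant of the connected component.  This is why a component contains only one
  root.\<close>

lemma rtrancl_parent_edges_same_root:
  assumes f: "f \<in> parent_functions V E"
    and "(v, w) \<in> (edge_rel (parent_edges V f))\<^sup>*"
  shows "(\<exists>d. reaches_root f v d r) \<longleftrightarrow> (\<exists>d. reaches_root f w d r)"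
  using assms(2)
proof induction
  case (step w z)
  hence "f w = Some z \<or> f z = Some w"
    using parent_edges_iff[OF f] by auto
  with step.IH show ?case
    by (auto simp: reaches_root_Some)
qed simp

lemma reaches_root_imp_connected:
  assumes f: "f \<in> parent_functions V E"
    and "reaches_root f v d r" "v \<in> V"
  shows "r \<in> parentless V f \<and> (v, r) \<in> (edge_rel (parent_edges V f))\<^sup>*"
  using assms(2,3)
proof induction
  case (root r)
  thus ?case by (simp add: parentless_def)
next
  case (step v w d r)
  have "{v, w} \<in> E" using parent_edge[OF f] step by blast
  hence "w \<in> V" using edge_ends by blast
  moreover have "(v, w) \<in> edge_rel (parent_edges V f)"
    using step by (auto simp: parent_edges_def)
  ultimately show ?case
    using step.IH by (meson converse_rtrancl_into_rtrancl)
qed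

lemma parent_edges_is_forest:
  assumes f: "f \<in> grounded_parent_functions"
  shows "(parent_edges V f, parentless V f) \<in>
           rooted_spanning_forests \<lparr>vertices = V, edges = E\<rparr>"
proof -
  have f': "f \<in> parent_functions V E" and gr: "\<And>v. v \<in> V \<Longrightarrow> grounded f v"
    using f by (auto simp: grounded_parent_functions_def)
  have "\<exists>!r. r \<in> parentless V f \<and> (v, r) \<in> (edge_rel (parent_edges V f))\<^sup>*" if v: "v \<in> V" for v
  proof (rule ex_ex1I)
    show "\<exists>r. r \<in> parentless V f \<and> (v, r) \<in> (edge_rel (parent_edges V f))\<^sup>*"
      using gr[OF v] reaches_root_imp_connected[OF f'] v by (auto simp: grounded_def)
  next
    have reach: "\<exists>d. reaches_root f v d r"
      if "r \<in> parentless V f \<and> (v, r) \<in> (edge_rel (parent_edges V f))\<^sup>*" for r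
      using that rtrancl_parent_edges_same_root[OF f', of v r r]
      by (auto simp: parentless_def intro: reaches_root.root)
    fix r r'
    assume "r \<in> parentless V f \<and> (v, r) \<in> (edge_rel (parent_edges V f))\<^sup>*"
      and "r' \<in> parentless V f \<and> (v, r') \<in> (edge_rel (parent_edges V f))\<^sup>*"
    thus "r = r'"
      using reach reaches_root_unique by metis
  qed
  moreover have "parent_edges V f \<subseteq> E"
    using parent_edge[OF f'] by (auto simp: parent_edges_def)
  ultimately show ?thesis
    using parent_edges_acyclic[OF f] unfolding rooted_spanning_forests_def unique_root_iff
    by (simp add: parentless_def)
qed

text \<open>The edges alone do not orient the forest; the roots do.  By induction along the path to the root,
  once the parent of \<open>w\<close> is known to be the same for \<open>f\<close> and \<open>g\<close>, an edge \<open>{v, w}\<close> with \<open>f v = Some w\<close>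
  cannot be the edge from \<open>w\<close> to its parent, so it has to be the edge from \<open>v\<close> to its parent for \<open>g\<close> too.\<close>

lemma inj_on_parent_edges:
  "inj_on (\<lambda>f. (parent_edges V f, parentless V f)) grounded_parent_functions"
proof (rule inj_onI)
  fix f g
  assume f: "f \<in> grounded_parent_functions" and g: "g \<in> grounded_parent_functions"
    and eq: "(parent_edges V f, parentless V f) = (parent_edges V g, parentless V g)"
  have f': "f \<in> parent_functions V E" and gr: "\<And>v. v \<in> V \<Longrightarrow> grounded f v"
    and g': "g \<in> parent_functions V E"
    using f g by (auto simp: grounded_parent_functions_def)
  have "v \<in> V \<Longrightarrow> f v = g v" if "grounded f v" for v
    using that
  proof (induction rule: grounded_induct)
    case (root r)
    hence "r \<in> parentless V f" by (simp add: parentless_def)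
    hence "r \<in> parentless V g" using eq by simp
    thus ?case using root by (simp add: parentless_def)
  next
    case (step v w)
    have w: "w \<in> V" using parent_edge[OF f'] step edge_ends by blast
    have "{v, w} \<in> parent_edges V f"
      using step by (auto simp: parent_edges_def)
    hence "g v = Some w \<or> g w = Some v"
      using eq parent_edges_iff[OF g'] by auto
    moreover have "g w \<noteq> Some v"
    proof
      assume "g w = Some v"
      hence "f w = Some v" using step w by simp
      hence "depth f w = Suc (depth f v)" "depth f v = Suc (depth f w)"
        using step.hyps step.prems gr depth_Some by metis+
      thus False by simp
    qed
    ultimately show ?case using step by simp
  qed
  hence "f v = g v" if "v \<in> V" for v using that gr by blast
  thus "f = g"
    using f' g' unfolding parent_functions_def by (intro PiE_ext)
qed

text \<open>The parent of a vertex is a neighbour that is closer to the set of roots.  The edges between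
  vertices and their parents already connect every vertex to the root of its component, so a further
  edge of \<open>F\<close> would close a cycle.\<close>

lemma forest_has_parent_function:
  assumes "(F, R) \<in> rooted_spanning_forests \<lparr>vertices = V, edges = E\<rparr>"
  shows "\<exists>f \<in> grounded_parent_functions. parent_edges V f = F \<and> parentless V f = R"
proof -
  have FE: "F \<subseteq> E" and acyc: "\<nexists>c. is_cycle F c" and RV: "R \<subseteq> V"
    and root: "\<And>v. v \<in> V \<Longrightarrow> \<exists>!r. r \<in> R \<and> (v, r) \<in> (edge_rel F)\<^sup>*"
    using assms unfolding rooted_spanning_forests_def unique_root_iff by auto
  define dist where "dist v = (LEAST n. \<exists>r\<in>R. (v, r) \<in> edge_rel F ^^ n)" for v
  have closer: "\<exists>w. {v, w} \<in> F \<and> dist w < dist v" if v: "v \<in> V" "v \<notin> R" for v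
  proof -
    have "\<exists>n. \<exists>r\<in>R. (v, r) \<in> edge_rel F ^^ n"
      using root[OF v(1)] rtrancl_imp_relpow by blast
    hence "\<exists>r\<in>R. (v, r) \<in> edge_rel F ^^ dist v"
      unfolding dist_def by (rule LeastI_ex)
    then obtain r where r: "r \<in> R" "(v, r) \<in> edge_rel F ^^ dist v" by blast
    have "dist v \<noteq> 0" using r v by (metis relpow_0_E)
    then obtain n where n: "dist v = Suc n" by (cases "dist v") auto
    then obtain w where w: "{v, w} \<in> F" "(w, r) \<in> edge_rel F ^^ n"
      using r(2) by (metis (mono_tags, lifting) case_prodD mem_Collect_eq relpow_Suc_D2)
    have "dist w \<le> n"
      unfolding dist_def by (rule Least_le) (use w r in blast)
    with w n show ?thesis by auto
  qed
  define f where "f v = (if v \<in> V then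
      (if v \<in> R then None else Some (SOME w. {v, w} \<in> F \<and> dist w < dist v)) else undefined)" for v
  have f_Some: "v \<notin> R \<and> {v, w} \<in> F \<and> dist w < dist v" if "v \<in> V" "f v = Some w" for v w
    using that someI_ex[OF closer[of v]] by (auto simp: f_def split: if_splits)
  have f_None: "f v = None \<longleftrightarrow> v \<in> R" if "v \<in> V" for v
    using that by (simp add: f_def)
  have f: "f \<in> parent_functions V E"
    unfolding parent_functions_def
  proof (rule PiE_I)
    fix v assume v: "v \<in> V"
    show "f v \<in> insert None (Some ` neighbours E v)"
      using f_Some[OF v] FE by (cases "f v") (auto simp: neighbours_def)
  qed (simp add: f_def)
  have grounded: "grounded f v" if "v \<in> V" for v
    using that
  proof (induction "dist v" arbitrary: v rule: less_induct)
    case less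
    show ?case
    proof (cases "f v")
      case None
      thus ?thesis by (rule grounded_None)
    next
      case (Some w)
      have w: "{v, w} \<in> F" "dist w < dist v"
        using f_Some less.prems Some by blast+
      hence "w \<in> V" using FE edge_ends by blast
      hence "grounded f w" using less.hyps w by blast
      thus ?thesis using grounded_Some[of f v w] Some by simp
    qed
  qed
  have parentless: "parentless V f = R"
    using f_None RV by (auto simp: parentless_def)
  have sub: "parent_edges V f \<subseteq> F"
    using f_Some by (auto simp: parent_edges_def)
  have "F \<subseteq> parent_edges V f"
  proof
    fix e assume e: "e \<in> F"
    then obtain x y where xy: "e = {x, y}" "x \<in> V" "y \<in> V" "x \<noteq> y"
      using FE edges_between_vertices by blast
    show "e \<in> parent_edges V f"
    proof (rule ccontr)
      assume notin: "e \<notin> parent_edges V f"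
      let ?P = "edge_rel (parent_edges V f)"
      have mono: "?P\<^sup>* \<subseteq> (edge_rel F)\<^sup>*" "?P\<^sup>* \<subseteq> (edge_rel (F - {e}))\<^sup>*"
        using sub notin by (intro rtrancl_mono; blast)+
      have reach: "\<exists>r\<in>R. (v, r) \<in> ?P\<^sup>*" if v: "v \<in> V" for v
        using grounded[OF v] reaches_root_imp_connected[OF f] v parentless
        unfolding grounded_def by metis
      obtain r where r: "r \<in> R" "(x, r) \<in> ?P\<^sup>*" using reach xy by blast
      obtain r' where r': "r' \<in> R" "(y, r') \<in> ?P\<^sup>*" using reach xy by blast
      have "(x, y) \<in> edge_rel F" using e xy by simp
      hence "(x, r') \<in> (edge_rel F)\<^sup>*"
        using r'(2) mono(1) by (meson converse_rtrancl_into_rtrancl subsetD)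
      hence "r' = r" using root[OF xy(2)] r r' mono(1) by blast
      hence "(x, y) \<in> ?P\<^sup>*"
        using r(2) edge_rel_rtrancl_sym[OF r'(2)] by simp
      hence "(x, y) \<in> (edge_rel (F - {{x, y}}))\<^sup>*" using mono(2) xy(1) by blast
      thus False
        using connected_by_other_edges_imp_cycle e xy acyc by metis
    qed
  qed
  with sub parentless f grounded show ?thesis
    by (intro bexI[of _ f]) (auto simp: grounded_parent_functions_def)
qed

theorem bij_betw_parent_functions_forests:
  "bij_betw (\<lambda>f. (parent_edges V f, parentless V f)) grounded_parent_functions
     (rooted_spanning_forests \<lparr>vertices = V, edges = E\<rparr>)"
  using inj_on_parent_edges parent_edges_is_forest forest_has_parent_function
  unfolding bij_betw_def by force

end

section \<open>The matrix forest theorem\<close>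

text \<open>The matrix is the identity minus the adjacency matrix of the functional graph of \<open>f\<close>.  If all
  vertices are grounded, a permutation with a nonzero term in the Leibniz formula moves each vertex
  to itself or to its parent.  Going down from the roots, it fixes every vertex, since it is
  injective and already fixes the parent; only the identity contributes.  Otherwise, a vertex is
  ungrounded if and only if its parent exists and is ungrounded, so the indicator vector of the
  ungrounded vertices lies in the kernel.\<close>

lemma det_parent_function:
  fixes f :: "nat \<Rightarrow> nat option"
  assumes f: "\<And>i j. i < N \<Longrightarrow> f i = Some j \<Longrightarrow> j < N"
  shows "Determinant.det (mat N N (\<lambda>(i, j). of_bool (i = j) - of_bool (f i = Some j))) =
           (of_bool (\<forall>i<N. grounded f i) :: 'a :: field)"
    (is "Determinant.det ?A = _")
proof (cases "\<forall>i<N. grounded f i")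
  case True
  have id: "p = id" if p: "p permutes {0..<N}" and nz: "\<And>i. i < N \<Longrightarrow> p i = i \<or> f i = Some (p i)" for p
  proof
    fix i
    show "p i = id i"
    proof (cases "i < N")
      case i: True
      have "i < N \<Longrightarrow> p i = i" if "grounded f i" for i
        using that
      proof (induction rule: grounded_induct)
        case (root r)
        thus ?case using nz[of r] by auto
      next
        case (step v w)
        show ?case
        proof (rule ccontr)
          assume "p v \<noteq> v"
          hence "p v = w" using nz[of v] step by auto
          moreover have "p w = w" using step f by blast
          ultimately show False
            using permutes_inj[OF p] \<open>p v \<noteq> v\<close> by (metis injD)
        qed
      qed
      thus ?thesis using True i by simp
    qed (use permutes_not_in[OF p] in auto)
  qed
  have "Determinant.det ?A = (\<Sum>p\<in>{p. p permutes {0..<N}}. signof p * (\<Prod>i = 0..<N. ?A $$ (i, p i)))"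
    by (rule det_def') simp
  also have "\<dots> = (\<Sum>p\<in>{id}. signof p * (\<Prod>i = 0..<N. ?A $$ (i, p i)))"
  proof (rule sum.mono_neutral_right)
    show "\<forall>p\<in>{p. p permutes {0..<N}} - {id}. signof p * (\<Prod>i = 0..<N. ?A $$ (i, p i)) = 0"
    proof
      fix p assume "p \<in> {p. p permutes {0..<N}} - {id}"
      hence p: "p permutes {0..<N}" and "p \<noteq> id" by auto
      then obtain i where i: "i < N" "p i \<noteq> i" "f i \<noteq> Some (p i)"
        using id by blast
      moreover have "p i < N" using permutes_in_image[OF p, of i] i(1) by simp
      ultimately have "?A $$ (i, p i) = 0" by auto
      hence "(\<Prod>i = 0..<N. ?A $$ (i, p i)) = 0"
        using i(1) by (meson atLeastLessThan_iff finite_atLeastLessThan prod_zero zero_le)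
      thus "signof p * (\<Prod>i = 0..<N. ?A $$ (i, p i)) = 0" by simp
    qed
  qed (auto intro: permutes_id finite_permutations)
  also have "\<dots> = (\<Prod>i = 0..<N. ?A $$ (i, i))" by simp
  also have "\<dots> = (\<Prod>i = 0..<N. 1)"
  proof (rule prod.cong)
    fix i assume "i \<in> {0..<N}"
    moreover have "f i \<noteq> Some i"
    proof
      assume "f i = Some i"
      hence "depth f i = Suc (depth f i)"
        using True \<open>i \<in> {0..<N}\<close> depth_Some by (metis atLeastLessThan_iff)
      thus False by simp
    qed
    ultimately show "?A $$ (i, i) = 1" by simp
  qed simp
  finally show ?thesis using True by simp
next
  case False
  define v :: "'a vec" where "v = vec N (\<lambda>i. of_bool (\<not> grounded f i))"
  have v: "v \<in> carrier_vec N" by (simp add: v_def)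
  obtain i where "i < N" "\<not> grounded f i" using False by blast
  hence "v \<noteq> 0\<^sub>v N" by (auto simp: v_def vec_eq_iff)
  moreover have "?A *\<^sub>v v = 0\<^sub>v N"
  proof (rule eq_vecI)
    fix i assume "i < dim_vec (0\<^sub>v N :: 'a vec)"
    hence i: "i < N" by simp
    have "(?A *\<^sub>v v) $ i =
        (\<Sum>j = 0..<N. (of_bool (i = j) - of_bool (f i = Some j)) * of_bool (\<not> grounded f j))"
      using i by (simp add: v_def scalar_prod_def)
    also have "\<dots> = (\<Sum>j = 0..<N. if j = i then of_bool (\<not> grounded f j) else 0)
        - (\<Sum>j = 0..<N. if f i = Some j then of_bool (\<not> grounded f j) else 0)"
      unfolding sum_subtractf[symmetric] by (intro sum.cong) auto
    also have "\<dots> = 0"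
    proof (cases "f i")
      case None
      thus ?thesis using i grounded_None[of f i] by simp
    next
      case (Some k)
      thus ?thesis using i f[OF i Some] grounded_Some[of f i k] by simp
    qed
    finally show "(?A *\<^sub>v v) $ i = 0\<^sub>v N $ i" using i by simp
  qed simp
  ultimately have "Determinant.det ?A = 0"
    using det_0_iff_vec_prod_zero[of ?A N] v by auto
  with False show ?thesis by simp
qed

definition laplacian_plus_one :: "nat \<Rightarrow> nat set set \<Rightarrow> 'a :: comm_ring_1 mat" where
  "laplacian_plus_one N E = mat N N (\<lambda>(i, j).
     of_bool (i = j) * (1 + of_nat (card (neighbours E i))) - of_bool ({i, j} \<in> E))"

text \<open>Row \<open>i\<close> of \<open>I + L\<close> is the sum of the rows \<open>e\<^sub>i - e\<^sub>c\<close> over the possible values \<open>c\<close> of a parent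
  function at \<open>i\<close>, where having no parent contributes \<open>e\<^sub>i\<close>.  By multilinearity, the determinant is
  the sum over all parent functions of the determinants computed in \<open>det_parent_function\<close>, so it
  counts the acyclic ones.\<close>

theorem matrix_forest_theorem:
  assumes "simple_graph {0..<N} E"
  shows "Determinant.det (laplacian_plus_one N E) =
           (of_nat (num_rooted_spanning_forests \<lparr>vertices = {0..<N}, edges = E\<rparr>) :: 'a :: field)"
proof -
  interpret simple_graph "{0..<N}" E by fact
  let ?S = "\<lambda>i. insert None (Some ` neighbours E i)"
  let ?a = "\<lambda>i j c. of_bool (i = j) - of_bool (c = Some j) :: 'a"
  have nb: "neighbours E i \<subseteq> {0..<N}" for i
    using edge_ends by (auto simp: neighbours_def)
  hence fin: "finite (neighbours E i)" for i
    using finite_subset by blast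
  have entry: "laplacian_plus_one N E $$ (i, j) = (\<Sum>c\<in>?S i. ?a i j c)" if "i < N" "j < N" for i j
  proof -
    have "(\<Sum>c\<in>?S i. ?a i j c) = of_bool (i = j) + (\<Sum>w\<in>neighbours E i. ?a i j (Some w))"
      by (subst sum.insert) (auto simp: fin sum.reindex)
    also have "(\<Sum>w\<in>neighbours E i. ?a i j (Some w)) =
        of_nat (card (neighbours E i)) * of_bool (i = j) - (\<Sum>w\<in>neighbours E i. if w = j then 1 else 0)"
      by (simp add: sum_subtractf of_bool_def)
    also have "(\<Sum>w\<in>neighbours E i. if w = j then 1 else 0) = (of_bool ({i, j} \<in> E) :: 'a)"
      using fin[of i] by (simp add: neighbours_def)
    finally show ?thesis
      using that by (simp add: laplacian_plus_one_def algebra_simps)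
  qed
  have finP: "finite (parent_functions {0..<N} E)"
    unfolding parent_functions_def using fin by (intro finite_PiE) auto
  have "Determinant.det (laplacian_plus_one N E :: 'a mat) =
      (\<Sum>p\<in>{p. p permutes {0..<N}}. signof p * (\<Prod>i = 0..<N. laplacian_plus_one N E $$ (i, p i)))"
    by (rule det_def') (simp add: laplacian_plus_one_def)
  also have "\<dots> = (\<Sum>p\<in>{p. p permutes {0..<N}}. signof p * (\<Prod>i = 0..<N. \<Sum>c\<in>?S i. ?a i (p i) c))"
    by (intro sum.cong refl arg_cong2[of _ _ _ _ "(*)"] prod.cong entry)
       (auto simp: permutes_in_image)
  also have "\<dots> = (\<Sum>p\<in>{p. p permutes {0..<N}}. signof p *
      (\<Sum>f\<in>parent_functions {0..<N} E. \<Prod>i = 0..<N. ?a i (p i) (f i)))"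
    unfolding parent_functions_def by (subst prod_sum_PiE) (auto simp: fin)
  also have "\<dots> = (\<Sum>f\<in>parent_functions {0..<N} E. \<Sum>p\<in>{p. p permutes {0..<N}}.
      signof p * (\<Prod>i = 0..<N. ?a i (p i) (f i)))"
    unfolding sum_distrib_left by (rule sum.swap)
  also have "\<dots> = (\<Sum>f\<in>parent_functions {0..<N} E.
      Determinant.det (mat N N (\<lambda>(i, j). ?a i j (f i))))"
    by (intro sum.cong refl, subst det_def'[of _ N])
       (auto intro!: sum.cong prod.cong simp: permutes_in_image)
  also have "\<dots> = (\<Sum>f\<in>parent_functions {0..<N} E. of_bool (\<forall>i\<in>{0..<N}. grounded f i))"
  proof (intro sum.cong refl)
    fix f assume f: "f \<in> parent_functions {0..<N} E"
    have "j < N" if "i < N" "f i = Some j" for i j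
      using parent_edge[OF f _ that(2)] that(1) edge_ends by fastforce
    thus "Determinant.det (mat N N (\<lambda>(i, j). ?a i j (f i))) =
        (of_bool (\<forall>i\<in>{0..<N}. grounded f i) :: 'a)"
      using det_parent_function[of N f] by (simp add: Ball_def)
  qed
  also have "\<dots> = of_nat (card grounded_parent_functions)"
    using finP by (simp add: grounded_parent_functions_def of_bool_def sum.If_cases Int_def)
  also have "card grounded_parent_functions =
      num_rooted_spanning_forests \<lparr>vertices = {0..<N}, edges = E\<rparr>"
    unfolding num_rooted_spanning_forests_def
    by (rule bij_betw_same_card[OF bij_betw_parent_functions_forests])
  finally show ?thesis .
qed

section \<open>Circulant determinants\<close>

lemma bij_betw_add_mod:
  assumes "i < (m :: nat)"
  shows "bij_betw (\<lambda>d. (i + d) mod m) {..<m} {..<m}"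
    and "d < m \<Longrightarrow> ((i + d) mod m + m - i) mod m = d"
proof -
  have inv: "((i + d) mod m + m - i) mod m = d" if "d < m" for d
  proof (cases "i + d < m")
    case False
    hence "(i + d) mod m = i + d - m"
      using assms that by (simp add: mod_if)
    thus ?thesis using False assms that by simp
  qed (use that in simp)
  thus "d < m \<Longrightarrow> ((i + d) mod m + m - i) mod m = d" .
  have "inj_on (\<lambda>d. (i + d) mod m) {..<m}"
    by (rule inj_onI) (metis inv lessThan_iff)
  moreover have "(\<lambda>d. (i + d) mod m) ` {..<m} \<subseteq> {..<m}"
    using assms by auto
  ultimately show "bij_betw (\<lambda>d. (i + d) mod m) {..<m} {..<m}"
    by (simp add: bij_betw_def endo_inj_surj)
qed

lemma diff_mod_eq_0_iff:
  assumes "i < m" "j < (m :: nat)"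
  shows "(j + m - i) mod m = 0 \<longleftrightarrow> i = j"
proof -
  have "(j + m - i) mod m = 0 \<longleftrightarrow> (if i \<le> j then j - i else j + m - i) = 0"
    using assms by (auto simp: mod_if)
  thus ?thesis using assms by auto
qed

definition root_unity :: "nat \<Rightarrow> nat \<Rightarrow> complex" where
  "root_unity m k = cis (2 * pi * real k / real m)"

lemma root_unity_power: "root_unity m k ^ j = root_unity m (k * j)"
  by (simp add: root_unity_def Complex.DeMoivre mult_ac)

lemma root_unity_add: "root_unity m (j + k) = root_unity m j * root_unity m k"
  by (simp add: root_unity_def cis_mult add_divide_distrib ring_distribs)

lemma root_unity_mod:
  assumes "m > 0"
  shows "root_unity m ((k mod m) * l) = root_unity m (k * l)"
proof -
  have period: "root_unity m (m * j) = 1" for j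
    using assms cis_multiple_2pi[of "real j"] by (simp add: root_unity_def mult.assoc)
  have "k * l = (k mod m) * l + m * ((k div m) * l)"
    by (metis add_mult_distrib mod_mult_div_eq mult.assoc)
  thus ?thesis
    by (simp add: root_unity_add period)
qed

lemma inj_on_root_unity: "m > 0 \<Longrightarrow> inj_on (root_unity m) {..<m}"
  using Complex.bij_betw_roots_unity[of m] by (simp add: bij_betw_def root_unity_def[abs_def])

text \<open>A vector in the kernel is the coefficient vector of a polynomial of degree less than \<open>m\<close> that
  vanishes at all \<open>m\<close>-th roots of unity.\<close>

lemma det_fourier_nonzero:
  assumes "m > 0"
  shows "Determinant.det (mat m m (\<lambda>(j, l). root_unity m (j * l))) \<noteq> 0"
    (is "Determinant.det ?W \<noteq> 0")
proof
  assume "Determinant.det ?W = 0"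
  then obtain v where v: "v \<in> carrier_vec m" "v \<noteq> 0\<^sub>v m" "?W *\<^sub>v v = 0\<^sub>v m"
    using det_0_iff_vec_prod_zero[of ?W m] by auto
  define p where "p = (\<Sum>l<m. monom (v $ l) l)"
  have "degree p \<le> m - 1"
    unfolding p_def by (intro degree_sum_le order.trans[OF degree_monom_le]) auto
  moreover have "card (root_unity m ` {..<m}) = m"
    using inj_on_root_unity[OF assms] by (simp add: card_image)
  moreover have "poly p x = poly 0 x" if "x \<in> root_unity m ` {..<m}" for x
  proof -
    obtain j where j: "j < m" "x = root_unity m j" using \<open>x \<in> _\<close> by auto
    have "poly p x = (\<Sum>l<m. root_unity m (j * l) * v $ l)"
      by (simp add: p_def poly_sum poly_monom j root_unity_power mult_ac)
    also have "\<dots> = (?W *\<^sub>v v) $ j"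
      using j v(1) by (simp add: scalar_prod_def lessThan_atLeast0)
    finally show ?thesis using v(3) j by simp
  qed
  ultimately have "p = 0"
    using assms by (intro poly_eqI_degree[of "root_unity m ` {..<m}"]) auto
  have "v $ l = 0" if "l < m" for l
  proof -
    have "coeff p l = v $ l"
      using that by (simp add: p_def coeff_sum)
    thus ?thesis using \<open>p = 0\<close> by simp
  qed
  hence "v = 0\<^sub>v m" using v(1) by (intro eq_vecI) auto
  with v(2) show False by simp
qed

text \<open>The columns of the Fourier matrix are eigenvectors of every circulant matrix; comparing
  determinants in \<open>M W = W \<Lambda>\<close> only requires \<open>det W \<noteq> 0\<close>.\<close>

lemma det_circulant:
  fixes c :: "nat \<Rightarrow> complex"
  assumes m: "m > 0"
  shows "Determinant.det (mat m m (\<lambda>(i, j). c ((j + m - i) mod m))) =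
           (\<Prod>l<m. \<Sum>d<m. c d * root_unity m (d * l))"
    (is "Determinant.det ?M = prod ?lam _")
proof -
  let ?W = "mat m m (\<lambda>(j, l). root_unity m (j * l))"
  let ?L = "mat m m (\<lambda>(i, j). if i = j then ?lam i else 0)"
  have "?M * ?W = ?W * ?L"
  proof (rule eq_matI)
    fix i l assume "i < dim_row (?W * ?L)" "l < dim_col (?W * ?L)"
    hence il: "i < m" "l < m" by auto
    have "(?M * ?W) $$ (i, l) = (\<Sum>j<m. c ((j + m - i) mod m) * root_unity m (j * l))"
      using il by (simp add: scalar_prod_def lessThan_atLeast0)
    also have "\<dots> = (\<Sum>d<m. c (((i + d) mod m + m - i) mod m) * root_unity m (((i + d) mod m) * l))"
      by (rule sum.reindex_bij_betw[OF bij_betw_add_mod(1)[OF il(1)], symmetric])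
    also have "\<dots> = (\<Sum>d<m. root_unity m (i * l) * (c d * root_unity m (d * l)))"
      by (intro sum.cong refl, subst root_unity_mod[OF m])
       (simp add: bij_betw_add_mod(2)[OF il(1)] root_unity_add ring_distribs mult_ac)
    also have "\<dots> = root_unity m (i * l) * ?lam l"
      by (simp add: sum_distrib_left)
    also have "\<dots> = (\<Sum>j<m. if j = l then root_unity m (i * j) * ?lam j else 0)"
      using il by simp
    also have "\<dots> = (?W * ?L) $$ (i, l)"
      using il by (simp add: scalar_prod_def lessThan_atLeast0 if_distrib cong: if_cong)
    finally show "(?M * ?W) $$ (i, l) = (?W * ?L) $$ (i, l)" .
  qed auto
  hence "Determinant.det ?M * Determinant.det ?W = Determinant.det ?W * Determinant.det ?L"
    by (metis (no_types, lifting) Determinant.det_mult mat_carrier)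
  moreover have "Determinant.det ?L = prod ?lam {..<m}"
    by (subst det_lower_triangular[of m])
       (auto simp: prod_list_diag_prod lessThan_atLeast0)
  ultimately show ?thesis
    using det_fourier_nonzero[OF m] by simp
qed

section \<open>Chebyshev polynomials and products over cosines\<close>

lemma prod_minus_root_unity:
  assumes n: "n > 0" and a: "a \<noteq> 0"
  shows "(\<Prod>j<n. z - a * root_unity n j) = z ^ n - a ^ n"
proof -
  have "(\<Prod>j<n. [:- root_unity n j, 1:]) = monom 1 n - 1" (is "?p = ?q")
  proof (rule poly_eqI_degree_lead_coeff[of _ n _ "root_unity n ` {..<n}"])
    show "n \<le> card (root_unity n ` {..<n})"
      using inj_on_root_unity[OF n] by (simp add: card_image)
    show "degree ?p \<le> n"
      by (rule order.trans[OF degree_prod_sum_le]) auto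
    show "degree ?q \<le> n"
      by (intro degree_diff_le) (auto simp: degree_monom_eq)
    have "degree ?p = n"
      by (subst degree_prod_sum_eq) auto
    moreover have "lead_coeff ?p = 1"
      by (simp add: lead_coeff_prod)
    ultimately show "coeff ?p n = coeff ?q n"
      using n by simp
    fix x assume "x \<in> root_unity n ` {..<n}"
    then obtain j where j: "j < n" "x = root_unity n j" by auto
    have "root_unity n j ^ n = 1"
      using root_unity_mod[OF n, of n j] n
      by (simp add: root_unity_power mult.commute) (simp add: root_unity_def)
    moreover have "poly ?p x = 0"
      using j by (auto simp: poly_prod)
    ultimately show "poly ?p x = poly ?q x"
      by (simp add: poly_monom j)
  qed
  hence "poly ?p (z / a) = poly ?q (z / a)" by simp
  hence "(\<Prod>j<n. z / a - root_unity n j) = (z / a) ^ n - 1"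
    by (simp add: poly_prod poly_monom)
  hence "a ^ n * (\<Prod>j<n. z / a - root_unity n j) = z ^ n - a ^ n"
    using a by (simp add: field_simps)
  moreover have "a ^ n * (\<Prod>j<n. z / a - root_unity n j) = (\<Prod>j<n. a * (z / a - root_unity n j))"
    by (simp add: prod.distrib)
  ultimately show ?thesis
    using a by (simp add: right_diff_distrib)
qed

text \<open>Put \<open>u = (z + 1/z)/2\<close>.  With \<open>a = cis \<alpha>\<close> and \<open>w\<close> running through the numbers \<open>a \<omega>\<close> for the \<open>n\<close>-th roots of
  unity \<open>\<omega>\<close>, a factor is \<open>(z - w) (z - cnj w) / z\<close>, so the product is
  \<open>(z\<^sup>n - a\<^sup>n) (z\<^sup>n - cnj a\<^sup>n) / z\<^sup>n = z\<^sup>n + 1/z\<^sup>n - 2 cos (n \<alpha>)\<close>, and \<open>z\<^sup>n + 1/z\<^sup>n = 2 T\<^sub>n(u)\<close>.  The shift \<open>\<alpha>\<close> covers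
  both products that occur below: \<open>\<alpha> = 0\<close> yields \<open>2 T\<^sub>n(u) - 2\<close>, and \<open>\<alpha> = \<pi>/n\<close> yields \<open>2 T\<^sub>n(u) + 2\<close>.\<close>

lemma chebyshev_prod_cos:
  assumes n: "n > 0"
  shows "(\<Prod>j<n. 2 * u - 2 * of_real (cos (\<alpha> + 2 * pi * real j / real n))) =
           2 * poly (chebyshev_T n) u - 2 * of_real (cos (real n * \<alpha>))"
proof -
  define x where "x = Arccos u"
  define z where "z = exp (\<i> * x)"
  have z: "z \<noteq> 0" by (simp add: z_def)
  have two_cos: "2 * cos w = exp (\<i> * w) + inverse (exp (\<i> * w))" for w :: complex
    by (simp add: cos_exp_eq exp_minus)
  have two_cos_real: "2 * of_real (cos t) = cis t + cnj (cis t)" for t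
    by (simp add: complex_eq_iff)
  have factor: "2 * u - 2 * of_real (cos (\<alpha> + 2 * pi * real j / real n)) =
      inverse z * ((z - cis \<alpha> * root_unity n j) * (z - cnj (cis \<alpha> * root_unity n j)))" for j
  proof -
    define w where "w = cis \<alpha> * root_unity n j"
    have w: "w = cis (\<alpha> + 2 * pi * real j / real n)"
      by (simp add: w_def root_unity_def cis_mult)
    have "w * cnj w = 1" by (simp add: w cis_cnj cis_mult)
    hence "inverse z * ((z - w) * (z - cnj w)) = z + inverse z - (w + cnj w)"
      using z by (simp add: field_simps)
    moreover have "2 * u = z + inverse z"
      using two_cos[of x] by (simp add: x_def z_def)
    ultimately show ?thesis
      unfolding two_cos_real by (simp add: w[symmetric] w_def[symmetric])
  qed
  have cnj_prod: "(\<Prod>j<n. z - cnj (cis \<alpha> * root_unity n j)) = z ^ n - cnj (cis \<alpha>) ^ n"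
  proof -
    have "(\<Prod>j<n. z - cnj (cis \<alpha> * root_unity n j)) = cnj (\<Prod>j<n. cnj z - cis \<alpha> * root_unity n j)"
      by (simp)
    also have "\<dots> = z ^ n - cnj (cis \<alpha>) ^ n"
      by (subst prod_minus_root_unity[OF n]) auto
    finally show ?thesis .
  qed
  have "(\<Prod>j<n. 2 * u - 2 * of_real (cos (\<alpha> + 2 * pi * real j / real n))) =
      inverse z ^ n * ((z ^ n - cis \<alpha> ^ n) * (z ^ n - cnj (cis \<alpha>) ^ n))"
    unfolding factor using cnj_prod
    by (simp add: prod.distrib prod_minus_root_unity[OF n])
  also have "\<dots> = z ^ n + inverse (z ^ n) - (cis \<alpha> ^ n + cnj (cis \<alpha> ^ n))"
  proof -
    have "cis \<alpha> ^ n * cnj (cis \<alpha>) ^ n = 1"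
      by (simp add: cis_cnj cis_mult flip: power_mult_distrib)
    thus ?thesis
      using z by (simp add: field_simps)
  qed
  also have "z ^ n + inverse (z ^ n) = 2 * poly (chebyshev_T n) u"
    using two_cos[of "of_nat n * x"]
    by (simp add: poly_chebyshev_T x_def[symmetric] z_def mult_ac flip: exp_of_nat_mult)
  also have "cis \<alpha> ^ n + cnj (cis \<alpha> ^ n) = 2 * of_real (cos (real n * \<alpha>))"
    by (simp only: two_cos_real Complex.DeMoivre)
  finally show ?thesis .
qed

text \<open>This is the resultant of \<open>P\<close> with a polynomial whose roots are the given cosines: the product over
  the cosines is exchanged with the product over the roots of \<open>P\<close>.\<close>

lemma prod_poly_cos:
  fixes P :: "complex poly" and r :: "nat \<Rightarrow> complex"
  assumes n: "n > 0" and roots: "image_mset r (mset_set {1..d}) = proots P"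
  shows "(\<Prod>j<n. poly P (of_real (cos (\<alpha> + 2 * pi * real j / real n)))) =
           (lead_coeff P * (- 1 / 2) ^ d) ^ n *
           (\<Prod>p = 1..d. 2 * poly (chebyshev_T n) (r p) - 2 * of_real (cos (real n * \<alpha>)))"
proof -
  let ?x = "\<lambda>j. complex_of_real (cos (\<alpha> + 2 * pi * real j / real n))"
  have "P = Polynomial.smult (lead_coeff P) (\<Prod>x\<in>#proots P. [:-x, 1:])"
    by (simp only: complex_poly_decompose_multiset)
  also have "(\<Prod>x\<in>#proots P. [:-x, 1:]) = (\<Prod>p = 1..d. [:- r p, 1:])"
    by (simp add: roots[symmetric] prod_unfold_prod_mset image_mset.compositionality comp_def)
  finally have poly: "P = Polynomial.smult (lead_coeff P) (\<Prod>p = 1..d. [:- r p, 1:])" .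
  have eval: "poly P x = lead_coeff P * (\<Prod>p = 1..d. x - r p)" for x
    by (subst poly) (simp add: poly_prod)
  have "(\<Prod>j<n. poly P (?x j)) = lead_coeff P ^ n * (\<Prod>p = 1..d. \<Prod>j<n. ?x j - r p)"
    unfolding eval prod.distrib by (subst prod.swap) simp
  also have "(\<lambda>p. \<Prod>j<n. ?x j - r p) = (\<lambda>p. (- 1 / 2) ^ n *
      (2 * poly (chebyshev_T n) (r p) - 2 * of_real (cos (real n * \<alpha>))))"
  proof
    fix p
    have "(\<Prod>j<n. ?x j - r p) = (\<Prod>j<n. (- 1 / 2) * (2 * r p - 2 * ?x j))"
      by (intro prod.cong) (auto simp: field_simps)
    also have "\<dots> = (- 1 / 2) ^ n * (\<Prod>j<n. 2 * r p - 2 * ?x j)"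
      by (subst prod.distrib) simp
    finally show "(\<Prod>j<n. ?x j - r p) = (- 1 / 2) ^ n *
        (2 * poly (chebyshev_T n) (r p) - 2 * of_real (cos (real n * \<alpha>)))"
      by (simp only: chebyshev_prod_cos[OF n])
  qed
  finally show ?thesis
    by (simp add: prod.distrib power_mult_distrib mult_ac flip: power_mult)
qed

lemma degree_lead_coeff_chebyshev_T:
  "degree (chebyshev_T n) \<le> n \<and> coeff (chebyshev_T n) n = (if n = 0 then 1 else 2 ^ (n - 1))"
proof (induction n rule: chebyshev_T.induct)
  case (3 n)
  have "degree ([:0, 2:] * chebyshev_T (Suc n)) \<le> Suc (Suc n)"
    using degree_mult_le[of "[:0, 2:]" "chebyshev_T (Suc n)"] 3 by simp
  moreover have "coeff (chebyshev_T n) (Suc (Suc n)) = 0"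
    using 3 by (intro coeff_eq_0) auto
  ultimately show ?case
    using 3 by (auto intro!: degree_diff_le simp: numeral_2_eq_2)
qed simp_all

lemma degree_lead_coeff_Q_poly:
  fixes c :: complex
  assumes "k \<ge> 1" "1 \<le> s 1" "strict_mono_on {1..k} s"
  shows "degree (Q_poly k s + [:c:]) = s k" "lead_coeff (Q_poly k s + [:c:]) = - (2 ^ s k)"
proof -
  let ?P = "Q_poly k s + [:c:]"
  have le: "s i < s k" if "i \<in> {1..k}" "i \<noteq> k" for i
    using that assms by (intro strict_mono_onD[OF assms(3)]) auto
  have le1: "s i \<le> s k" if "i \<in> {1..k}" for i
    using le[OF that] by (cases "i = k") auto
  have sk: "s k \<ge> 1"
    using le1[of 1] assms by simp
  have Q: "?P = [:of_nat (2 * k + 2) + c:] - Polynomial.smult 2 (\<Sum>i = 1..k. chebyshev_T (s i))"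
    by (simp add: Q_poly_def of_nat_poly numeral_poly)
  have "degree (\<Sum>i = 1..k. chebyshev_T (s i)) \<le> s k"
    using degree_lead_coeff_chebyshev_T le1 by (intro degree_sum_le) (auto intro: order.trans)
  hence deg: "degree ?P \<le> s k"
    unfolding Q by (intro degree_diff_le order.trans[OF degree_smult_le]) auto
  have "coeff (\<Sum>i = 1..k. chebyshev_T (s i)) (s k) = (\<Sum>i = 1..k. if i = k then 2 ^ (s k - 1) else 0)"
    unfolding coeff_sum
  proof (intro sum.cong refl)
    fix i assume i: "i \<in> {1..k}"
    show "coeff (chebyshev_T (s i)) (s k) = (if i = k then 2 ^ (s k - 1) else 0)"
    proof (cases "i = k")
      case False
      hence "degree (chebyshev_T (s i)) < s k"
        using le[OF i] degree_lead_coeff_chebyshev_T[of "s i"] by simp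
      with False show ?thesis by (simp add: coeff_eq_0)
    qed (use degree_lead_coeff_chebyshev_T[of "s k"] sk in simp)
  qed
  also have "\<dots> = 2 ^ (s k - 1)" using assms(1) by simp
  finally have "coeff ?P (s k) = - (2 ^ s k)"
    using sk unfolding Q by (cases "s k") (auto simp: coeff_pCons)
  moreover from this have "degree ?P = s k"
    using deg by (intro antisym le_degree) auto
  ultimately show "degree ?P = s k" "lead_coeff ?P = - (2 ^ s k)" by simp_all
qed

section \<open>The forests of circulant graphs\<close>

text \<open>The differences between adjacent vertices, as residues in \<open>{0<..<m}\<close>.  Being a set, it takes care of
  the single edge that \<open>t = m / 2\<close> contributes at each vertex.\<close>

definition circulant_steps :: "nat \<Rightarrow> nat set \<Rightarrow> nat set" where
  "circulant_steps m J = {d. 0 < d \<and> d < m \<and>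
     (\<exists>t\<in>J. [int d = int t] (mod int m) \<or> [int d = - int t] (mod int m))}"

lemma circulant_edge_iff:
  assumes "i < m" "j < m"
  shows "{i, j} \<in> edges (circulant_graph m J) \<longleftrightarrow> (j + m - i) mod m \<in> circulant_steps m J"
proof -
  define d where "d = (j + m - i) mod m"
  have d_int: "int d = (int j - int i) mod int m"
  proof -
    have "int (j + m - i) = (int j - int i) + int m" using assms by simp
    thus ?thesis by (simp only: d_def zmod_int mod_add_self2)
  qed
  have d0: "d = 0 \<longleftrightarrow> i = j"
    using assms by (simp add: d_def diff_mod_eq_0_iff)
  have "[int d = x] (mod int m) \<longleftrightarrow> [int j = int i + x] (mod int m)" for x
    by (simp add: d_int cong_iff_dvd_diff[of "int j - int i"] cong_iff_dvd_diff[of "int j"] algebra_simps)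
  hence steps: "d \<in> circulant_steps m J \<longleftrightarrow> i \<noteq> j \<and>
      (\<exists>t\<in>J. [int j = int i + int t] (mod int m) \<or> [int j = int i - int t] (mod int m))"
    using assms d0 by (auto simp: circulant_steps_def d_def)
  have swap: "[int i = int j + x] (mod int m) \<longleftrightarrow> [int j = int i - x] (mod int m)" for x
    by (simp add: cong_iff_dvd_diff dvd_diff_commute[of _ "int i"] algebra_simps)
  have "{i, j} \<in> edges (circulant_graph m J) \<longleftrightarrow> i \<noteq> j \<and>
      (\<exists>t\<in>J. [int j = int i + int t] (mod int m) \<or> [int j = int i - int t] (mod int m))"
    using assms swap[of "int _"] swap[of "- int _"]
    by (auto simp: circulant_graph_def doubleton_eq_iff)
  thus ?thesis
    using steps by (simp add: d_def)
qed

lemma simple_graph_circulant: "simple_graph {0..<m} (edges (circulant_graph m J))"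
  by unfold_locales (auto simp: circulant_graph_def)

lemma card_neighbours_circulant:
  assumes "i < m"
  shows "card (neighbours (edges (circulant_graph m J)) i) = card (circulant_steps m J)"
proof -
  let ?f = "\<lambda>d. (i + d) mod m"
  interpret simple_graph "{0..<m}" "edges (circulant_graph m J)"
    by (rule simple_graph_circulant)
  note bij = bij_betw_add_mod[OF assms]
  have sub: "circulant_steps m J \<subseteq> {..<m}"
    by (auto simp: circulant_steps_def)
  have "neighbours (edges (circulant_graph m J)) i = ?f ` circulant_steps m J"
  proof (intro equalityI subsetI)
    fix j assume "j \<in> neighbours (edges (circulant_graph m J)) i"
    hence edge: "{i, j} \<in> edges (circulant_graph m J)" by (simp add: neighbours_def)
    hence "j < m" using edge_ends by fastforce
    then obtain d where d: "d < m" "j = ?f d"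
      using bij_betw_imp_surj_on[OF bij(1)] by blast
    hence "d \<in> circulant_steps m J"
      using edge circulant_edge_iff[OF assms \<open>j < m\<close>] bij(2) by simp
    thus "j \<in> ?f ` circulant_steps m J" using d by blast
  next
    fix j assume "j \<in> ?f ` circulant_steps m J"
    then obtain d where d: "d \<in> circulant_steps m J" "j = ?f d" by blast
    moreover have "d < m" using d sub by blast
    moreover have "j < m" using d assms by simp
    ultimately have "{i, j} \<in> edges (circulant_graph m J)"
      unfolding circulant_edge_iff[OF assms \<open>j < m\<close>] by (simp only: bij(2))
    thus "j \<in> neighbours (edges (circulant_graph m J)) i"
      by (simp add: neighbours_def)
  qed
  moreover have "inj_on ?f (circulant_steps m J)"
    using bij(1) sub by (auto simp: bij_betw_def intro: inj_on_subset)
  ultimately show ?thesis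
    by (simp add: card_image)
qed

text \<open>The matrix \<open>I + L\<close> of a circulant graph is circulant, so its determinant is the product of its
  eigenvalues.\<close>

theorem num_forests_circulant:
  assumes m: "m > 0"
  shows "of_nat (num_rooted_spanning_forests (circulant_graph m J)) =
    (\<Prod>l<m. 1 + of_nat (card (circulant_steps m J)) -
       (\<Sum>d\<in>circulant_steps m J. root_unity m (d * l)))"
proof -
  let ?E = "edges (circulant_graph m J)" and ?D = "circulant_steps m J"
  define c :: "nat \<Rightarrow> complex" where
    "c d = of_bool (d = 0) * (1 + of_nat (card ?D)) - of_bool (d \<in> ?D)" for d
  have sub: "?D \<subseteq> {..<m}"
    by (auto simp: circulant_steps_def)
  have "laplacian_plus_one m ?E = mat m m (\<lambda>(i, j). c ((j + m - i) mod m))"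
  proof (rule eq_matI)
    fix i j
    assume "i < dim_row (mat m m (\<lambda>(i, j). c ((j + m - i) mod m)))"
      and "j < dim_col (mat m m (\<lambda>(i, j). c ((j + m - i) mod m)))"
    hence ij: "i < m" "j < m" by auto
    thus "laplacian_plus_one m ?E $$ (i, j) = mat m m (\<lambda>(i, j). c ((j + m - i) mod m)) $$ (i, j)"
      using ij by (simp add: laplacian_plus_one_def c_def card_neighbours_circulant
          circulant_edge_iff diff_mod_eq_0_iff)
  qed (auto simp: laplacian_plus_one_def)
  moreover have "circulant_graph m J = \<lparr>vertices = {0..<m}, edges = ?E\<rparr>"
    by (simp add: circulant_graph_def)
  ultimately have "of_nat (num_rooted_spanning_forests (circulant_graph m J)) =
      Determinant.det (mat m m (\<lambda>(i, j). c ((j + m - i) mod m)))"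
    using matrix_forest_theorem[OF simple_graph_circulant[of m J], where 'a = complex] by simp
  also have "\<dots> = (\<Prod>l<m. \<Sum>d<m. c d * root_unity m (d * l))"
    by (rule det_circulant[OF m])
  also have "\<dots> = (\<Prod>l<m. 1 + of_nat (card ?D) - (\<Sum>d\<in>?D. root_unity m (d * l)))"
  proof (intro prod.cong refl)
    fix l
    have "(\<Sum>d<m. c d * root_unity m (d * l)) =
        (\<Sum>d<m. if d = 0 then 1 + of_nat (card ?D) else 0) -
        (\<Sum>d<m. if d \<in> ?D then root_unity m (d * l) else 0)"
      unfolding sum_subtractf[symmetric]
      by (intro sum.cong) (auto simp: c_def root_unity_def)
    also have "(\<Sum>d<m. if d \<in> ?D then root_unity m (d * l) else 0) =
        (\<Sum>d\<in>?D. root_unity m (d * l))"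
      using sub by (simp add: sum.inter_restrict[symmetric] Int_absorb1)
    finally show "(\<Sum>d<m. c d * root_unity m (d * l)) =
        1 + of_nat (card ?D) - (\<Sum>d\<in>?D. root_unity m (d * l))"
      using m by simp
  qed
  finally show ?thesis .
qed

text \<open>The steps \<open>t\<close> and \<open>2 n - t\<close> for \<open>t \<in> S\<close> and the antipodal step \<open>n\<close>, which is its own negative, are
  pairwise different.\<close>

lemma sum_circulant_steps_antipodal:
  fixes g :: "nat \<Rightarrow> 'a :: comm_monoid_add"
  assumes S: "S \<subseteq> {0<..<n}" and n: "n > 0"
  shows "sum g (circulant_steps (2 * n) (S \<union> {n})) = g n + (\<Sum>t\<in>S. g t + g (2 * n - t))"
proof -
  let ?r = "\<lambda>t. 2 * n - t"
  have fin: "finite S" using S finite_subset by blast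
  have lt: "t < n" "n < ?r t" if "t \<in> S" for t
    using that S by fastforce+
  have pos: "[int d = int t] (mod int (2 * n)) \<longleftrightarrow> d = t" if "d < 2 * n" "t \<le> n" for d t
    using that n by (auto simp: cong_int_iff cong_def)
  have neg: "[int d = - int t] (mod int (2 * n)) \<longleftrightarrow> d = ?r t" if "d < 2 * n" "0 < t" "t \<le> n" for d t
  proof -
    have "[int d = - int t] (mod int (2 * n)) \<longleftrightarrow> [int d = int (?r t)] (mod int (2 * n))"
      using that by (simp add: cong_def)
    also have "\<dots> \<longleftrightarrow> [d = ?r t] (mod 2 * n)"
      by (rule cong_int_iff)
    also have "\<dots> \<longleftrightarrow> d = ?r t"
      using that n by (simp add: cong_def)
    finally show ?thesis .
  qed
  have "circulant_steps (2 * n) (S \<union> {n}) = {n} \<union> (S \<union> ?r ` S)"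
  proof (intro equalityI subsetI)
    fix d assume "d \<in> circulant_steps (2 * n) (S \<union> {n})"
    then obtain t where "d < 2 * n" "t \<in> S \<union> {n}"
      "[int d = int t] (mod int (2 * n)) \<or> [int d = - int t] (mod int (2 * n))"
      by (auto simp: circulant_steps_def)
    moreover from this have "0 < t" "t \<le> n" using S n by auto
    ultimately show "d \<in> {n} \<union> (S \<union> ?r ` S)"
      using pos[of d t] neg[of d t] by auto
  next
    fix d assume "d \<in> {n} \<union> (S \<union> ?r ` S)"
    then obtain t where t: "t \<in> S \<union> {n}" "d = t \<or> d = ?r t" by auto
    hence "0 < t" "t \<le> n" "0 < d" "d < 2 * n" using S n by auto
    with t show "d \<in> circulant_steps (2 * n) (S \<union> {n})"
      using pos[of d t] neg[of d t] unfolding circulant_steps_def by blast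
  qed
  moreover have "inj_on ?r S"
    using lt(1) by (intro inj_onI) fastforce
  moreover have "S \<inter> ?r ` S = {}" "n \<notin> S \<union> ?r ` S"
    using lt by fastforce+
  ultimately show ?thesis
    using fin by (simp add: sum.union_disjoint sum.reindex sum.distrib)
qed

text \<open>Opposite steps \<open>t\<close> and \<open>2 n - t\<close> contribute conjugate roots of unity, hence twice a cosine, which is a
  Chebyshev polynomial in \<open>cos (\<pi> l / n)\<close>; the antipodal step contributes the sign \<open>(-1)\<^sup>l\<close>.\<close>

lemma circulant_eigenvalue:
  assumes inj: "inj_on s {1..k}" and S: "s ` {1..k} \<subseteq> {0<..<n}" and n: "n > 0"
  shows "1 + of_nat (card (circulant_steps (2 * n) (s ` {1..k} \<union> {n}))) -
      (\<Sum>d\<in>circulant_steps (2 * n) (s ` {1..k} \<union> {n}). root_unity (2 * n) (d * l)) =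
    poly (Q_poly k s) (of_real (cos (pi * real l / real n))) - (- 1) ^ l"
proof -
  let ?D = "circulant_steps (2 * n) (s ` {1..k} \<union> {n})"
  have "card ?D = 1 + 2 * card (s ` {1..k})"
    using sum_circulant_steps_antipodal[OF S n, of "\<lambda>_. 1 :: nat"] by simp
  hence card: "card ?D = 2 * k + 1"
    using inj by (simp add: card_image)
  have pair: "root_unity (2 * n) (t * l) + root_unity (2 * n) ((2 * n - t) * l) =
      2 * of_real (cos (real t * (pi * real l / real n)))" if "t \<in> s ` {1..k}" for t
  proof -
    have t: "t \<le> 2 * n" using that S by auto
    have "root_unity (2 * n) (t * l) * root_unity (2 * n) ((2 * n - t) * l) =
        root_unity (2 * n) ((2 * n mod (2 * n)) * l)"
      using t n by (subst root_unity_mod) (simp_all flip: root_unity_add add_mult_distrib)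
    hence "root_unity (2 * n) ((2 * n - t) * l) = inverse (root_unity (2 * n) (t * l))"
      by (metis inverse_unique mod_self mult_zero_left root_unity_def cis_zero of_nat_0
          mult_zero_right div_0)
    moreover have "root_unity (2 * n) (t * l) = cis (real t * (pi * real l / real n))"
      using n by (simp add: root_unity_def mult_ac)
    ultimately show ?thesis
      by (simp add: complex_eq_iff)
  qed
  have "root_unity (2 * n) n = - 1"
    using n by (simp add: root_unity_def)
  hence half: "root_unity (2 * n) (n * l) = (- 1) ^ l"
    by (simp flip: root_unity_power)
  have "(\<Sum>d\<in>?D. root_unity (2 * n) (d * l)) =
      (- 1) ^ l + (\<Sum>t\<in>s ` {1..k}. 2 * of_real (cos (real t * (pi * real l / real n))))"
    using sum_circulant_steps_antipodal[OF S n, of "\<lambda>d. root_unity (2 * n) (d * l)"] pair half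
    by simp
  also have "(\<Sum>t\<in>s ` {1..k}. 2 * of_real (cos (real t * (pi * real l / real n)))) =
      2 * (\<Sum>i = 1..k. poly (chebyshev_T (s i)) (of_real (cos (pi * real l / real n))))"
    using poly_chebyshev_T_cos[of _ "of_real (pi * real l / real n)"] inj
    by (simp add: sum.reindex sum_distrib_left flip: cos_of_real)
  finally have steps: "(\<Sum>d\<in>?D. root_unity (2 * n) (d * l)) = (- 1) ^ l +
      2 * (\<Sum>i = 1..k. poly (chebyshev_T (s i)) (of_real (cos (pi * real l / real n))))" .
  show ?thesis
    unfolding steps card by (simp add: Q_poly_def poly_sum)
qed

lemma prod_even_odd:
  fixes g :: "nat \<Rightarrow> 'a :: comm_monoid_mult"
  shows "(\<Prod>l<2 * n. g l) = (\<Prod>j<n. g (2 * j)) * (\<Prod>j<n. g (2 * j + 1))"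
  by (induction n) (simp_all add: mult_ac)

text \<open>Splitting the eigenvalues by the parity of the index \<open>l\<close> gives values of \<open>Q - 1\<close> at the cosines of
  \<open>2\<pi>j/n\<close> and of \<open>Q + 1\<close> at the cosines of \<open>\<pi>/n + 2\<pi>j/n\<close>.\<close>

theorem theorem2:
  fixes k n :: nat and s :: "nat \<Rightarrow> nat" and u v :: "nat \<Rightarrow> complex"
  assumes "k \<ge> 1"
    and "1 \<le> s 1"
    and "strict_mono_on {1..k} s"
    and "s k < n"
    and "image_mset u (mset_set {1..s k}) = proots (Q_poly k s - 1)"
    and "image_mset v (mset_set {1..s k}) = proots (Q_poly k s + 1)"
  shows "of_nat (num_rooted_spanning_forests (circulant_graph (2 * n) (s ` {1..k} \<union> {n}))) =
    (\<Prod>p = 1..s k. (2 * poly (chebyshev_T n) (u p) - 2) * (2 * poly (chebyshev_T n) (v p) + 2))"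
proof -
  let ?Q = "Q_poly k s"
  have n: "n > 0" using assms(4) by simp
  have inj: "inj_on s {1..k}"
    using assms(3) by (rule strict_mono_on_imp_inj_on)
  have mono: "s i \<le> s j" if "1 \<le> i" "i \<le> j" "j \<le> k" for i j
    using that strict_mono_on_leD[OF assms(3), of i j] by simp
  have S: "s ` {1..k} \<subseteq> {0<..<n}"
  proof safe
    fix i assume "i \<in> {1..k}"
    hence "s 1 \<le> s i" "s i \<le> s k" using mono by auto
    thus "s i \<in> {0<..<n}" using assms(2,4) by auto
  qed
  have one: "?Q - 1 = ?Q + [:- 1:]" "?Q + 1 = ?Q + [:1:]"
    by (simp_all add: one_pCons)
  have even: "(\<Prod>j<n. poly (?Q - 1) (of_real (cos (0 + 2 * pi * real j / real n)))) =
      (- (2 ^ s k) * (- 1 / 2) ^ s k) ^ n * (\<Prod>p = 1..s k. 2 * poly (chebyshev_T n) (u p) - 2)"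
    using prod_poly_cos[OF n assms(5), of 0] degree_lead_coeff_Q_poly[OF assms(1-3), of "- 1"]
    by (simp add: one)
  have odd: "(\<Prod>j<n. poly (?Q + 1) (of_real (cos (pi / real n + 2 * pi * real j / real n)))) =
      (- (2 ^ s k) * (- 1 / 2) ^ s k) ^ n * (\<Prod>p = 1..s k. 2 * poly (chebyshev_T n) (v p) + 2)"
    using prod_poly_cos[OF n assms(6), of "pi / real n"] n
      degree_lead_coeff_Q_poly[OF assms(1-3), of 1]
    by (simp add: one)
  \<comment> \<open>Each of the two products carries this factor \<open>\<plusminus>1\<close> to the power \<open>n\<close>, with the same sign in both.\<close>
  have sign: "(- (2 ^ s k) * (- 1 / 2) ^ s k) * (- (2 ^ s k) * (- 1 / 2) ^ s k) = (1 :: complex)"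
    by (simp flip: power_mult_distrib)
  have "of_nat (num_rooted_spanning_forests (circulant_graph (2 * n) (s ` {1..k} \<union> {n}))) =
      (\<Prod>l<2 * n. poly ?Q (of_real (cos (pi * real l / real n))) - (- 1) ^ l)"
    using num_forests_circulant[of "2 * n"] n by (simp only: circulant_eigenvalue[OF inj S n])
  also have "\<dots> = (\<Prod>j<n. poly (?Q - 1) (of_real (cos (0 + 2 * pi * real j / real n)))) *
      (\<Prod>j<n. poly (?Q + 1) (of_real (cos (pi / real n + 2 * pi * real j / real n))))"
    unfolding prod_even_odd
    by (intro arg_cong2[of _ _ _ _ "(*)"] prod.cong)
       (simp_all add: add_divide_distrib ring_distribs mult_ac)
  also have "\<dots> = ((- (2 ^ s k) * (- 1 / 2) ^ s k) * (- (2 ^ s k) * (- 1 / 2) ^ s k)) ^ n *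
      ((\<Prod>p = 1..s k. 2 * poly (chebyshev_T n) (u p) - 2) *
       (\<Prod>p = 1..s k. 2 * poly (chebyshev_T n) (v p) + 2))"
    unfolding even odd by (simp only: power_mult_distrib mult_ac)
  also have "\<dots> = (\<Prod>p = 1..s k. (2 * poly (chebyshev_T n) (u p) - 2) *
      (2 * poly (chebyshev_T n) (v p) + 2))"
    unfolding sign by (simp add: prod.distrib)
  finally show ?thesis .
qed

end
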